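(* Let $(E,\mathcal{E})$ and $(F,\mathcal{F})$ be measurable spaces, let $\mu$ be a probability measure on $(F,\mathcal{F})$, and let $\widetilde T: E\times F\to E\times F$ be a dynamical system on $E\times F$ (equipped with the product $\sigma$-field). Define the mapping $L$ on $\mathcal{L}^\infty(E)$ by $$Lf(x)=\int_F T(f\otimes \mathbf{1})(x,y)\,d\mu(y)=\int_F (f\otimes \mathbf{1})(\widetilde T(x,y))\,d\mu(y),\qquad x\in E .$$ Then $L$ is a Markov operator on $E$.
   Context: For a measurable space $(E,\mathcal{E})$, $\mathcal{L}^\infty(E)$ is the space of bounded measurable functions on $E$. A dynamical system on a measurable space is a measurable map $\widetilde T$ from that space to itself; it induces the map $T$ on bounded measurable functions, $Tf=f\circ\widetilde T$. For $f\in\mathcal{L}^\infty(E)$, $f\otimes\mathbf{1}$ is the function on $E\times F$ given by $(f\otimes\mathbf{1})(x,y)=f(x)$. A Markov kernel on $(E,\mathcal{E})$ is a map $\nu:E\times\mathcal{E}\to[0,1]$ such that $x\mapsto\nu(x,A)$ is measurable for every $A\in\mathcal{E}$ and $A\mapsto\nu(x,A)$ is a probability measure for every $x\in E$. A Markov operator on $E$ is a linear operator on $\mathcal{L}^\infty(E)$ of the form $f\mapsto\int_E f(y)\,\nu(\cdot,dy)$ for some Markov kernel $\nu$. *)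

theory Defs
  imports "HOL-Probability.Probability"
begin

text \<open>
  A measurable space is represented by a value \<open>E :: 'a measure\<close> of which only \<open>space E\<close> and
  \<open>sets E\<close> are used. A function on it is a total function on the type \<open>'a\<close>; its values outside
  \<open>space E\<close> are junk, so identities between such functions are only required on \<open>space E\<close>.

  The class constraint on the scalars \<open>'c\<close> covers both the real and the complex numbers.
\<close>

definition L_infty ::
  "'a measure \<Rightarrow> ('a \<Rightarrow> 'c::{real_normed_field, banach, second_countable_topology}) set" where
  "L_infty E = {f. f \<in> borel_measurable E \<and> bounded (f ` space E)}"

definition dynamical_system :: "'a measure \<Rightarrow> ('a \<Rightarrow> 'a) \<Rightarrow> bool" where
  "dynamical_system M S \<longleftrightarrow> S \<in> M \<rightarrow>\<^sub>M M"

definition induced_map :: "('a \<Rightarrow> 'a) \<Rightarrow> ('a \<Rightarrow> 'c) \<Rightarrow> 'a \<Rightarrow> 'c" where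
  "induced_map S f = f \<circ> S"

definition tensor_one :: "('a \<Rightarrow> 'c) \<Rightarrow> 'a \<times> 'b \<Rightarrow> 'c" where
  "tensor_one f = (\<lambda>(x, y). f x)"

definition markov_kernel :: "'a measure \<Rightarrow> ('a \<Rightarrow> 'a measure) \<Rightarrow> bool" where
  "markov_kernel E \<nu> \<longleftrightarrow>
     (\<forall>A\<in>sets E. (\<lambda>x. measure (\<nu> x) A) \<in> borel_measurable E) \<and>
     (\<forall>x\<in>space E. sets (\<nu> x) = sets E \<and> prob_space (\<nu> x))"

text \<open>
  The second clause says that the operator depends only on the restriction of its argument to
  \<open>space E\<close>, i.e. that it acts on functions on \<open>E\<close> rather than on their extensions to the type.
\<close>

definition linear_operator_on_L_infty ::
  "'a measure \<Rightarrow> (('a \<Rightarrow> 'c::{real_normed_field, banach, second_countable_topology}) \<Rightarrow> 'a \<Rightarrow> 'c) \<Rightarrow> bool"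
where
  "linear_operator_on_L_infty E P \<longleftrightarrow>
     (\<forall>f\<in>L_infty E. P f \<in> L_infty E) \<and>
     (\<forall>f\<in>L_infty E. \<forall>g\<in>L_infty E.
        (\<forall>x\<in>space E. f x = g x) \<longrightarrow> (\<forall>x\<in>space E. P f x = P g x)) \<and>
     (\<forall>f\<in>L_infty E. \<forall>g\<in>L_infty E. \<forall>x\<in>space E. P (\<lambda>z. f z + g z) x = P f x + P g x) \<and>
     (\<forall>c. \<forall>f\<in>L_infty E. \<forall>x\<in>space E. P (\<lambda>z. c * f z) x = c * P f x)"

definition markov_operator ::
  "'a measure \<Rightarrow> (('a \<Rightarrow> 'c::{real_normed_field, banach, second_countable_topology}) \<Rightarrow> 'a \<Rightarrow> 'c) \<Rightarrow> bool"
where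
  "markov_operator E P \<longleftrightarrow>
     linear_operator_on_L_infty E P \<and>
     (\<exists>\<nu>. markov_kernel E \<nu> \<and>
       (\<forall>f\<in>L_infty E. \<forall>x\<in>space E. P f x = (\<integral>y. f y \<partial>(\<nu> x))))"

definition reduced_operator ::
  "'b measure \<Rightarrow> ('a \<times> 'b \<Rightarrow> 'a \<times> 'b)
    \<Rightarrow> ('a \<Rightarrow> 'c::{real_normed_field, banach, second_countable_topology}) \<Rightarrow> 'a \<Rightarrow> 'c"
where
  "reduced_operator \<mu> S f x = (\<integral>y. induced_map S (tensor_one f) (x, y) \<partial>\<mu>)"

lemma reduced_operator_eq:
  "reduced_operator \<mu> S f x = (\<integral>y. tensor_one f (S (x, y)) \<partial>\<mu>)"
  by (simp add: reduced_operator_def induced_map_def)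

end

theory Submission
  imports Defs
begin

text \<open>
  The kernel is the law \<open>\<nu>(x, \<cdot>)\<close> of the first component of \<open>T (x, y)\<close> when \<open>y\<close> is drawn from
  \<open>\<mu>\<close>; change of variables turns the integral against \<open>\<nu>(x, \<cdot>)\<close> into the one defining \<open>L\<close>.
\<close>

text \<open>A bounded function is dominated by a constant, which is integrable because the total
  mass is one. The separate \<open>M\<close> and \<open>E\<close> let this apply to every kernel
  measure on \<open>E\<close>.\<close>

lemma L_infty_integrable:
  fixes f :: "'a \<Rightarrow> 'c::{real_normed_field, banach, second_countable_topology}"
  assumes "prob_space M" "sets M = sets E" "f \<in> L_infty E"
  shows "integrable M f"
proof -
  interpret prob_space M by fact
  have f: "f \<in> borel_measurable M"
    using assms(2,3) by (simp add: L_infty_def cong: measurable_cong_sets)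
  obtain B where "\<forall>x\<in>space E. norm (f x) \<le> B"
    using assms(3) by (auto simp: L_infty_def bounded_iff)
  then show ?thesis
    using f sets_eq_imp_space_eq[OF assms(2)] by (intro integrable_const_bound[of _ B]) auto
qed

text \<open>Each \<open>y\<close> gives a self-map of \<open>E\<close>, namely \<open>\<phi>\<close>
  with its second argument frozen, and \<open>P\<close> averages \<open>f\<close> over these random
  maps. The reduced operator is the case where \<open>\<phi>\<close> is the first component of the
  dynamics.\<close>

lemma markov_operator_random_map:
  fixes P :: "('a \<Rightarrow> 'c::{real_normed_field, banach, second_countable_topology}) \<Rightarrow> 'a \<Rightarrow> 'c"
  assumes "prob_space \<mu>" and \<phi>: "\<phi> \<in> E \<Otimes>\<^sub>M \<mu> \<rightarrow>\<^sub>M E"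
    and P: "\<And>f x. P f x = (\<integral>y. f (\<phi> (x, y)) \<partial>\<mu>)"
  shows "markov_operator E P"
proof -
  interpret prob_space \<mu> by fact
  define \<nu> where "\<nu> x = distr \<mu> E (\<lambda>y. \<phi> (x, y))" for x
  have \<phi>_section: "(\<lambda>y. \<phi> (x, y)) \<in> \<mu> \<rightarrow>\<^sub>M E" if "x \<in> space E" for x
    using \<phi> that by measurable
  have sets_\<nu>: "sets (\<nu> x) = sets E" for x
    by (simp add: \<nu>_def)
  have prob_\<nu>: "prob_space (\<nu> x)" if "x \<in> space E" for x
    unfolding \<nu>_def by (intro prob_space_distr \<phi>_section that)
  have integrable_\<nu>: "integrable (\<nu> x) f" if "f \<in> L_infty E" "x \<in> space E"
    for f :: "'a \<Rightarrow> 'c" and x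
    by (rule L_infty_integrable[OF prob_\<nu>[OF that(2)] sets_\<nu> that(1)])
  \<comment> \<open>The value type \<open>'d\<close> is left free because this is used both at
    \<open>'c\<close>, for \<open>P\<close>, and at the reals, for indicators.\<close>
  have integral_\<nu>: "(\<integral>z. f z \<partial>\<nu> x) = (\<integral>y. f (\<phi> (x, y)) \<partial>\<mu>)"
    if "f \<in> borel_measurable E" "x \<in> space E"
    for f :: "'a \<Rightarrow> 'd::{banach, second_countable_topology}" and x
    unfolding \<nu>_def using that by (intro integral_distr \<phi>_section)
  \<comment> \<open>This is the measurability part of Fubini's theorem; \<open>\<mu>\<close> is
    sigma-finite because it is a probability measure.\<close>
  have measurable_integral: "(\<lambda>x. \<integral>y. f (\<phi> (x, y)) \<partial>\<mu>) \<in> borel_measurable E"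
    if f: "f \<in> borel_measurable E" for f :: "'a \<Rightarrow> 'd::{banach, second_countable_topology}"
  proof (rule borel_measurable_lebesgue_integral)
    show "(\<lambda>(x, y). f (\<phi> (x, y))) \<in> borel_measurable (E \<Otimes>\<^sub>M \<mu>)"
      using measurable_compose[OF \<phi> f] by (simp add: case_prod_unfold)
  qed
  have P_\<nu>: "P f x = (\<integral>z. f z \<partial>\<nu> x)" if "f \<in> L_infty E" "x \<in> space E" for f x
    using integral_\<nu>[of f x] that by (simp add: P L_infty_def)
  have kernel: "markov_kernel E \<nu>"
    unfolding markov_kernel_def
  proof (intro conjI ballI)
    fix A assume A: "A \<in> sets E"
    \<comment> \<open>Writing the mass of \<open>A\<close> as the integral of its indicator reduces
      measurability in \<open>x\<close> to \<open>measurable_integral\<close>.\<close>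
    have "measure (\<nu> x) A = (\<integral>y. indicator A (\<phi> (x, y)) \<partial>\<mu>)" if "x \<in> space E" for x
      using integral_\<nu>[of "indicator A :: 'a \<Rightarrow> real" x] A that sets.sets_into_space[OF A]
      by (simp add: \<nu>_def Int_absorb2)
    then show "(\<lambda>x. measure (\<nu> x) A) \<in> borel_measurable E"
      using measurable_integral[of "indicator A :: 'a \<Rightarrow> real"] A
      by (simp cong: measurable_cong)
  qed (simp_all add: sets_\<nu> prob_\<nu>)
  have maps: "P f \<in> L_infty E" if f: "f \<in> L_infty E" for f
  proof -
    obtain B where B: "\<forall>x\<in>space E. norm (f x) \<le> B"
      using f by (auto simp: L_infty_def bounded_iff)
    \<comment> \<open>Averaging against a probability measure preserves the bound \<open>B\<close>,
      uniformly in \<open>x\<close>.\<close>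
    have "norm (P f x) \<le> B" if x: "x \<in> space E" for x
    proof -
      interpret \<nu>: prob_space "\<nu> x" by (rule prob_\<nu>[OF x])
      have "norm (P f x) \<le> (\<integral>z. norm (f z) \<partial>\<nu> x)"
        unfolding P_\<nu>[OF f x] by (rule integral_norm_bound)
      also have "\<dots> \<le> B"
        using B integrable_\<nu>[OF f x]
        by (intro \<nu>.integral_le_const) (auto simp: sets_eq_imp_space_eq[OF sets_\<nu>])
      finally show ?thesis .
    qed
    moreover have "P f \<in> borel_measurable E"
      using measurable_integral[of f] f by (simp add: P[abs_def] L_infty_def)
    ultimately show ?thesis
      by (auto simp: L_infty_def bounded_iff)
  qed
  \<comment> \<open>The point \<open>\<phi> (x, y)\<close> stays in \<open>space E\<close>, so both
    integrands agree on all of \<open>space \<mu>\<close>.\<close>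
  have local: "P f x = P g x" if "\<forall>z\<in>space E. f z = g z" "x \<in> space E" for f g x
    unfolding P using that measurable_space[OF \<phi>_section]
    by (intro Bochner_Integration.integral_cong) auto
  \<comment> \<open>Additivity of the Bochner integral requires integrable summands; integrability
    is carried back from \<open>\<nu> x\<close> to \<open>\<mu>\<close>.\<close>
  have section_integrable: "integrable \<mu> (\<lambda>y. f (\<phi> (x, y)))"
    if "f \<in> L_infty E" "x \<in> space E" for f :: "'a \<Rightarrow> 'c" and x
    using integrable_\<nu>[OF that] integrable_distr[OF \<phi>_section] that by (simp add: \<nu>_def)
  have "linear_operator_on_L_infty E P"
    unfolding linear_operator_on_L_infty_def
    using maps local by (auto simp: P section_integrable)
  with kernel P_\<nu> show ?thesis
    unfolding markov_operator_def by blast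
qed

theorem theorem2p2:
  fixes E :: "'a measure" and F \<mu> :: "'b measure"
    and T :: "'a \<times> 'b \<Rightarrow> 'a \<times> 'b"
    and L :: "('a \<Rightarrow> 'c::{real_normed_field, banach, second_countable_topology}) \<Rightarrow> 'a \<Rightarrow> 'c"
  assumes "prob_space \<mu>" and "sets \<mu> = sets F"
    and "dynamical_system (E \<Otimes>\<^sub>M F) T"
    and "L = reduced_operator \<mu> T"
  shows "markov_operator E L"
proof (rule markov_operator_random_map)
  \<comment> \<open>\<open>F\<close> and \<open>\<mu>\<close> share their measurable sets, and the
    product sigma-algebra depends only on those, so measurability of \<open>T\<close>
    transfers.\<close>
  have "sets (E \<Otimes>\<^sub>M \<mu>) = sets (E \<Otimes>\<^sub>M F)"
    using assms(2) by (intro sets_pair_measure_cong) simp_all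
  then have "T \<in> E \<Otimes>\<^sub>M \<mu> \<rightarrow>\<^sub>M E \<Otimes>\<^sub>M F"
    using assms(3) by (simp add: dynamical_system_def cong: measurable_cong_sets)
  then show "fst \<circ> T \<in> E \<Otimes>\<^sub>M \<mu> \<rightarrow>\<^sub>M E"
    by (rule measurable_comp[OF _ measurable_fst])
  \<comment> \<open>\<open>tensor_one f\<close> reads only the first coordinate, so composing it
    with \<open>T\<close> yields \<open>f\<close> after \<open>fst \<circ> T\<close>.\<close>
  show "L f x = (\<integral>y. f ((fst \<circ> T) (x, y)) \<partial>\<mu>)" for f x
    by (simp add: assms(4) reduced_operator_eq tensor_one_def case_prod_unfold)
qed fact

end
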